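(* Let $\{a_n\}_{n\ge1}$ be a sequence of nonzero complex numbers, and let $f(z)$ be an entire function with zeros at $\{a_n\}$ listed according to their multiplicities. Suppose $f$ has a zero of order $k\ge0$ at the origin. If $X$ is a graphical isotropic minimal surface with height function $h(x,y)=\operatorname{Re}(\ln f(z))$, $z=x+iy$, then $h$ admits a decomposition on a simply connected domain excluding $\{a_n\}_{n\ge1}$ and $0$ into the following components: (1) a finite sum representing $k$ logarithmoids of revolution, given by $k\ln|z|$; (2) an infinite sum of dilated and translated logarithmoids of revolution, where the translation and dilation are determined by the factors $(1-z/a_n)$ associated with the nonzero zeros $a_n$ of $f$; (3) an infinite sum of graphical isotropic minimal surfaces given by the harmonic polynomials $\operatorname{Re}(P_n(z/a_n))$, derived from the Weierstrass primary factors of the Weierstrass product formula for $f$; (4) a graphical isotropic minimal surface given by the harmonic function $\operatorname{Re}(g(z))$, where $g$ is the entire function appearing in the Weierstrass product formula for $f$. Explicitly, $$h(x,y)=k\ln|z|+\operatorname{Re}[g(z)]+\sum_{n=1}^\infty\ln\left|1-\frac z{a_n}\right|+\sum_{n=1}^\infty\operatorname{Re}\left[P_n\!\left(\frac z{a_n}\right)\right].$$ Moreover, since the Weierstrass product representation of an entire function is not unique, the corresponding decomposition of the isotropic minimal surface is likewise not uniquely determined.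
   Context: Isotropic $3$-space $\mathbb I^3$ is $\mathbb R^3$ with the degenerate metric $dx^2+dy^2$; a graph $(x,y,h(x,y))$ is an isotropic minimal surface if and only if $\Delta h=0$. The logarithmoid of revolution is the graph of $\ln\sqrt{x^2+y^2}$. The Weierstrass product formula for $f$ is $f(z)=z^ke^{g(z)}\prod_{n=1}^\infty E_n(z/a_n)$, where $g$ is entire and $E_n(w)=(1-w)e^{P_n(w)}$ is the Weierstrass primary factor, with $P_n(w)=w+\frac{w^2}2+\dots+\frac{w^n}n$.
   Formalization: The two infinite sums need not converge separately (e.g. a_n = n), so h is stated as the limit of their joint partial sums; one sum converges iff the other does, and then the displayed formula holds as written. Non-uniqueness is shown by varying the degrees of the primary factors. *)

theory Defs
  imports "HOL-Complex_Analysis.Complex_Analysis"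
begin

text \<open>
  Isotropic space is modelled on \<^typ>\<open>real \<times> real \<times> real\<close>, its third coordinate being the
  isotropic direction. The top-view plane is identified with \<^typ>\<open>complex\<close>, so parameter
  domains are sets of complex numbers, while height functions take the two real coordinates.
\<close>

definition graph_over :: "complex set \<Rightarrow> (real \<Rightarrow> real \<Rightarrow> real) \<Rightarrow> (real \<times> real \<times> real) set" where
  "graph_over U h = {(x, y, h x y) | x y. Complex x y \<in> U}"

definition partial_x :: "(real \<Rightarrow> real \<Rightarrow> real) \<Rightarrow> real \<Rightarrow> real \<Rightarrow> real" where
  "partial_x h x y = deriv (\<lambda>t. h t y) x"

definition partial_y :: "(real \<Rightarrow> real \<Rightarrow> real) \<Rightarrow> real \<Rightarrow> real \<Rightarrow> real" where
  "partial_y h x y = deriv (\<lambda>t. h x t) y"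

definition partially_differentiable_on :: "complex set \<Rightarrow> (real \<Rightarrow> real \<Rightarrow> real) \<Rightarrow> bool" where
  "partially_differentiable_on U h \<longleftrightarrow>
     (\<forall>x y. Complex x y \<in> U \<longrightarrow>
        (\<lambda>t. h t y) differentiable (at x) \<and> (\<lambda>t. h x t) differentiable (at y))"

text \<open>Intended for open sets only. The differentiability conditions are explicit because
  \<^const>\<open>deriv\<close> is total.\<close>

definition C2_on :: "complex set \<Rightarrow> (real \<Rightarrow> real \<Rightarrow> real) \<Rightarrow> bool" where
  "C2_on U h \<longleftrightarrow>
     partially_differentiable_on U h \<and>
     partially_differentiable_on U (partial_x h) \<and>
     partially_differentiable_on U (partial_y h) \<and>
     continuous_on U (\<lambda>z. partial_x (partial_x h) (Re z) (Im z)) \<and>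
     continuous_on U (\<lambda>z. partial_y (partial_x h) (Re z) (Im z)) \<and>
     continuous_on U (\<lambda>z. partial_x (partial_y h) (Re z) (Im z)) \<and>
     continuous_on U (\<lambda>z. partial_y (partial_y h) (Re z) (Im z))"

definition laplacian :: "(real \<Rightarrow> real \<Rightarrow> real) \<Rightarrow> real \<Rightarrow> real \<Rightarrow> real" where
  "laplacian h x y = partial_x (partial_x h) x y + partial_y (partial_y h) x y"

text \<open>For a graph, the first fundamental form induced by the metric $dx^2 + dy^2$ is the identity
  and the second one is the Hessian of the height function, so the isotropic mean curvature
  vanishes exactly when the Laplacian does.\<close>

definition graphical_isotropic_minimal_surface :: "(real \<times> real \<times> real) set \<Rightarrow> bool" where
  "graphical_isotropic_minimal_surface X \<longleftrightarrow>
     (\<exists>U h. open U \<and> X = graph_over U h \<and> C2_on U h \<and>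
            (\<forall>x y. Complex x y \<in> U \<longrightarrow> laplacian h x y = 0))"

definition logarithmoid :: "(real \<times> real \<times> real) set" where
  "logarithmoid = graph_over (- {0}) (\<lambda>x y. ln (sqrt (x\<^sup>2 + y\<^sup>2)))"

text \<open>Dilation of the top view by the factor \<open>r\<close>, followed by the horizontal translation by \<open>c\<close>;
  heights are unchanged.\<close>

definition dilate_translate ::
    "real \<Rightarrow> complex \<Rightarrow> real \<times> real \<times> real \<Rightarrow> real \<times> real \<times> real" where
  "dilate_translate r c = (\<lambda>(x, y, t). (r * x + Re c, r * y + Im c, t))"

text \<open>The exponent of the primary factor:
  \<open>weierstrass_factor n w = (1 - w) * exp (weierstrass_poly n w)\<close>.\<close>

definition weierstrass_poly :: "nat \<Rightarrow> complex \<Rightarrow> complex" where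
  "weierstrass_poly n w = (\<Sum>j=1..n. w ^ j / of_nat j)"

text \<open>
  Sequences of zeros \<open>a\<close> are indexed from 1, and \<open>a 0\<close> is irrelevant: products and series over
  $n \ge 1$ appear below with \<open>Suc n\<close> in place of \<open>n\<close>. The sequence \<open>p\<close> selects the degrees of
  the primary factors; the Weierstrass product formula with factors $E_n(z/a_n)$ is the case
  \<open>p = (\<lambda>n. n)\<close>. Other choices of \<open>p\<close> are the source of the non-uniqueness of the
  representation.
\<close>

definition weierstrass_representation ::
    "(complex \<Rightarrow> complex) \<Rightarrow> nat \<Rightarrow> (nat \<Rightarrow> complex) \<Rightarrow> (nat \<Rightarrow> nat) \<Rightarrow> (complex \<Rightarrow> complex) \<Rightarrow> bool"
  where
  "weierstrass_representation f k a p g \<longleftrightarrow>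
     g holomorphic_on UNIV \<and>
     (\<forall>z. convergent_prod (\<lambda>n. weierstrass_factor (p (Suc n)) (z / a (Suc n))) \<and>
          f z = z ^ k * exp (g z) *
            (\<Prod>n. weierstrass_factor (p (Suc n)) (z / a (Suc n))))"

text \<open>
  In general neither $\sum_n \ln|1 - z/a_n|$ nor $\sum_n \mathrm{Re}\, P_n(z/a_n)$ converges by
  itself (take $a_n = n$), so the two infinite sums are truncated at the same index before passing
  to the limit. If one of the two series converges at \<open>z\<close>, then so does the other, and the
  formula holds with two separate infinite sums.
\<close>

definition height_formula ::
    "complex set \<Rightarrow> (real \<Rightarrow> real \<Rightarrow> real) \<Rightarrow> nat \<Rightarrow> (nat \<Rightarrow> complex) \<Rightarrow> (nat \<Rightarrow> nat) \<Rightarrow>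
       (complex \<Rightarrow> complex) \<Rightarrow> bool"
  where
  "height_formula D h k a p g \<longleftrightarrow>
     (\<forall>x y. Complex x y \<in> D \<longrightarrow>
       (let z = Complex x y;
            A = (\<lambda>n. ln (cmod (1 - z / a n)));
            B = (\<lambda>n. Re (weierstrass_poly (p n) (z / a n)))
        in (\<lambda>N. real k * ln (cmod z) + Re (g z) + (\<Sum>n=1..N. A n) + (\<Sum>n=1..N. B n))
             \<longlonglongrightarrow> h x y \<and>
           (summable (\<lambda>n. A (Suc n)) \<longleftrightarrow> summable (\<lambda>n. B (Suc n))) \<and>
           (summable (\<lambda>n. A (Suc n)) \<longrightarrow>
              h x y = real k * ln (cmod z) + Re (g z) + (\<Sum>n. A (Suc n)) + (\<Sum>n. B (Suc n)))))"

text \<open>The conjuncts after the formula describe the four kinds of components in turn.\<close>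

definition logarithmoid_decomposition ::
    "complex set \<Rightarrow> (real \<Rightarrow> real \<Rightarrow> real) \<Rightarrow> nat \<Rightarrow> (nat \<Rightarrow> complex) \<Rightarrow> (nat \<Rightarrow> nat) \<Rightarrow>
       (complex \<Rightarrow> complex) \<Rightarrow> bool"
  where
  "logarithmoid_decomposition D h k a p g \<longleftrightarrow>
     height_formula D h k a p g \<and>
     (graph_over (- {0}) (\<lambda>x y. ln (cmod (Complex x y))) = logarithmoid \<and>
      graphical_isotropic_minimal_surface logarithmoid \<and>
      (\<forall>z. real k * ln (cmod z) = (\<Sum>j=1..k. ln (cmod z)))) \<and>
     (\<forall>n\<ge>1.
        graph_over (- {a n}) (\<lambda>x y. ln (cmod (1 - Complex x y / a n))) =
          dilate_translate (cmod (a n)) (a n) ` logarithmoid \<and>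
        graphical_isotropic_minimal_surface
          (dilate_translate (cmod (a n)) (a n) ` logarithmoid)) \<and>
     (\<forall>n\<ge>1.
        real_polynomial_function (\<lambda>z. Re (weierstrass_poly (p n) (z / a n))) \<and>
        graphical_isotropic_minimal_surface
          (graph_over UNIV (\<lambda>x y. Re (weierstrass_poly (p n) (Complex x y / a n))))) \<and>
     graphical_isotropic_minimal_surface (graph_over UNIV (\<lambda>x y. Re (g (Complex x y))))"

end

theory Submission
  imports Defs
begin

text \<open>Since \<open>exp \<circ> L = f\<close> on \<open>D\<close>, the height is \<open>ln |f|\<close>, and taking \<open>ln |\<cdot>|\<close> of the partial products of
  a Weierstrass representation gives the decomposition. For the existence of a representation,
  \<open>f\<close> and \<open>z\<^sup>k\<close> times the canonical product have the same zero orders, so their quotient is a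
  zero-free entire function \<open>exp g\<close>. A second decomposition arises by moving a monomial from \<open>g\<close>
  into one primary factor; its real part cannot vanish throughout the open set \<open>D\<close>, because its
  derivative has no zero there.\<close>

section \<open>Coordinate derivatives and isotropic minimal graphs\<close>

text \<open>A horizontal line is traversed with velocity 1, so the chain rule gives the complex
  velocity \<open>F'\<close>, whose components are the two derivatives.\<close>

lemma has_real_derivative_horizontal:
  assumes "(F has_field_derivative F') (at (Complex x y))"
  shows "((\<lambda>t. Re (F (Complex t y))) has_real_derivative Re F') (at x)"
    and "((\<lambda>t. Im (F (Complex t y))) has_real_derivative Im F') (at x)"
proof -
  have "((\<lambda>t. of_real t + \<i> * of_real y) has_vector_derivative 1) (at x)"
    by (auto intro!: derivative_eq_intros)
  hence "((\<lambda>t. Complex t y) has_vector_derivative 1) (at x)"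
    by (simp add: Complex_eq)
  from field_vector_diff_chain_at[OF this assms]
  have "((\<lambda>t. F (Complex t y)) has_vector_derivative F') (at x)"
    by (simp add: o_def)
  from bounded_linear.has_vector_derivative[OF bounded_linear_Re this]
    bounded_linear.has_vector_derivative[OF bounded_linear_Im this]
  show "((\<lambda>t. Re (F (Complex t y))) has_real_derivative Re F') (at x)"
    and "((\<lambda>t. Im (F (Complex t y))) has_real_derivative Im F') (at x)"
    by (simp_all add: has_real_derivative_iff_has_vector_derivative)
qed

text \<open>Here the velocity is \<open>\<i>\<close>, and multiplication by \<open>\<i>\<close>
  swaps the components of \<open>F'\<close> with one change of sign. Together with the horizontal
  case this expresses the Cauchy-Riemann equations.\<close>

lemma has_real_derivative_vertical:
  assumes "(F has_field_derivative F') (at (Complex x y))"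
  shows "((\<lambda>t. Re (F (Complex x t))) has_real_derivative - Im F') (at y)"
    and "((\<lambda>t. Im (F (Complex x t))) has_real_derivative Re F') (at y)"
proof -
  have "((\<lambda>t. of_real x + \<i> * of_real t) has_vector_derivative \<i>) (at y)"
    by (auto intro!: derivative_eq_intros)
  hence "((\<lambda>t. Complex x t) has_vector_derivative \<i>) (at y)"
    by (simp add: Complex_eq)
  from field_vector_diff_chain_at[OF this assms]
  have "((\<lambda>t. F (Complex x t)) has_vector_derivative \<i> * F') (at y)"
    by (simp add: o_def)
  from bounded_linear.has_vector_derivative[OF bounded_linear_Re this]
    bounded_linear.has_vector_derivative[OF bounded_linear_Im this]
  show "((\<lambda>t. Re (F (Complex x t))) has_real_derivative - Im F') (at y)"
    and "((\<lambda>t. Im (F (Complex x t))) has_real_derivative Re F') (at y)"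
    by (simp_all add: has_real_derivative_iff_has_vector_derivative)
qed

text \<open>Formulas for the first partial derivatives will hold only over \<open>U\<close>; to
  differentiate them again they must hold near the point on each coordinate line.\<close>

lemma open_horizontal_slice: "open U \<Longrightarrow> open {t. Complex t y \<in> U}"
  unfolding Complex_eq by (rule open_vimage[unfolded vimage_def]) (auto intro!: continuous_intros)

lemma open_vertical_slice: "open U \<Longrightarrow> open {t. Complex x t \<in> U}"
  unfolding Complex_eq by (rule open_vimage[unfolded vimage_def]) (auto intro!: continuous_intros)

text \<open>The gradient of a harmonic function is encoded by a holomorphic \<open>G\<close> with
  \<open>h\<^sub>x = Re G\<close> and \<open>h\<^sub>y = - Im G\<close>. Unlike a holomorphic function with real part \<open>h\<close>, such a \<open>G\<close>
  exists on all of \<open>U\<close> even when \<open>U\<close> is not simply connected, which covers the logarithmoids.\<close>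

lemma graphical_isotropic_minimal_surface_gradient:
  assumes U: "open U" and G: "G holomorphic_on U"
    and hx: "\<And>x y. Complex x y \<in> U \<Longrightarrow>
               ((\<lambda>t. h t y) has_real_derivative Re (G (Complex x y))) (at x)"
    and hy: "\<And>x y. Complex x y \<in> U \<Longrightarrow>
               ((\<lambda>t. h x t) has_real_derivative - Im (G (Complex x y))) (at y)"
  shows "graphical_isotropic_minimal_surface (graph_over U h)"
proof -
  define G' where "G' = deriv G"
  have dG: "(G has_field_derivative G' z) (at z)" if "z \<in> U" for z
    using G U that unfolding G'_def by (rule holomorphic_derivI)
  have contG': "continuous_on U G'"
    unfolding G'_def by (intro holomorphic_on_imp_continuous_on holomorphic_deriv G U)
  have px: "partial_x h x y = Re (G (Complex x y))" if "Complex x y \<in> U" for x y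
    using hx[OF that] by (simp add: partial_x_def DERIV_imp_deriv)
  have py: "partial_y h x y = - Im (G (Complex x y))" if "Complex x y \<in> U" for x y
    using hy[OF that] by (simp add: partial_y_def DERIV_imp_deriv)
  have dxx: "((\<lambda>t. partial_x h t y) has_real_derivative Re (G' (Complex x y))) (at x)"
    if "Complex x y \<in> U" for x y
    by (rule has_field_derivative_transform_within_open[OF
          has_real_derivative_horizontal(1)[OF dG[OF that]] open_horizontal_slice[OF U]])
       (use that in \<open>auto simp: px\<close>)
  have dxy: "((\<lambda>t. partial_x h x t) has_real_derivative - Im (G' (Complex x y))) (at y)"
    if "Complex x y \<in> U" for x y
    by (rule has_field_derivative_transform_within_open[OF
          has_real_derivative_vertical(1)[OF dG[OF that]] open_vertical_slice[OF U]])
       (use that in \<open>auto simp: px\<close>)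
  have dyx: "((\<lambda>t. partial_y h t y) has_real_derivative - Im (G' (Complex x y))) (at x)"
    if "Complex x y \<in> U" for x y
    by (rule has_field_derivative_transform_within_open[OF
          DERIV_minus[OF has_real_derivative_horizontal(2)[OF dG[OF that]]]
          open_horizontal_slice[OF U]])
       (use that in \<open>auto simp: py\<close>)
  have dyy: "((\<lambda>t. partial_y h x t) has_real_derivative - Re (G' (Complex x y))) (at y)"
    if "Complex x y \<in> U" for x y
    by (rule has_field_derivative_transform_within_open[OF
          DERIV_minus[OF has_real_derivative_vertical(2)[OF dG[OF that]]]
          open_vertical_slice[OF U]])
       (use that in \<open>auto simp: py\<close>)
  \<comment> \<open>All four second derivatives are, up to sign, components of the continuous
    function \<open>G'\<close>; the two pure ones are opposite, so the Laplacian vanishes.\<close>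
  have pxx: "partial_x (partial_x h) x y = Re (G' (Complex x y))"
    and pxy: "partial_y (partial_x h) x y = - Im (G' (Complex x y))"
    and pyx: "partial_x (partial_y h) x y = - Im (G' (Complex x y))"
    and pyy: "partial_y (partial_y h) x y = - Re (G' (Complex x y))"
    if "Complex x y \<in> U" for x y
    using DERIV_imp_deriv[OF dxx[OF that]] DERIV_imp_deriv[OF dxy[OF that]]
      DERIV_imp_deriv[OF dyx[OF that]] DERIV_imp_deriv[OF dyy[OF that]]
    by (simp_all add: partial_x_def[of "partial_x h"] partial_x_def[of "partial_y h"]
        partial_y_def[of "partial_x h"] partial_y_def[of "partial_y h"])
  have "C2_on U h"
    unfolding C2_on_def
  proof (intro conjI)
    show "partially_differentiable_on U h" "partially_differentiable_on U (partial_x h)"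
      "partially_differentiable_on U (partial_y h)"
      unfolding partially_differentiable_on_def
      using hx hy dxx dxy dyx dyy real_differentiable_def by blast+
    have cont: "continuous_on U (\<lambda>z. Re (G' z))" "continuous_on U (\<lambda>z. - Re (G' z))"
      "continuous_on U (\<lambda>z. - Im (G' z))"
      by (intro continuous_intros contG')+
    show "continuous_on U (\<lambda>z. partial_x (partial_x h) (Re z) (Im z))"
      "continuous_on U (\<lambda>z. partial_y (partial_x h) (Re z) (Im z))"
      "continuous_on U (\<lambda>z. partial_x (partial_y h) (Re z) (Im z))"
      "continuous_on U (\<lambda>z. partial_y (partial_y h) (Re z) (Im z))"
      using cont by (simp_all add: pxx pxy pyx pyy cong: continuous_on_cong)
  qed
  moreover have "\<forall>x y. Complex x y \<in> U \<longrightarrow> laplacian h x y = 0"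
    by (simp add: laplacian_def pxx pyy)
  ultimately show ?thesis
    unfolding graphical_isotropic_minimal_surface_def using U by blast
qed

text \<open>By the Cauchy-Riemann equations the gradient of \<open>Re F\<close> is encoded by
  \<open>G = F'\<close>.\<close>

lemma graphical_isotropic_minimal_surface_Re:
  assumes "open U" "F holomorphic_on U"
  shows "graphical_isotropic_minimal_surface (graph_over U (\<lambda>x y. Re (F (Complex x y))))"
proof (rule graphical_isotropic_minimal_surface_gradient[OF assms(1), of "deriv F"])
  show "deriv F holomorphic_on U"
    using assms by (rule holomorphic_deriv[rotated -1])
qed (use assms in \<open>auto intro!: has_real_derivative_horizontal has_real_derivative_vertical
                     holomorphic_derivI\<close>)

section \<open>The logarithmoid, its dilations and translations\<close>

text \<open>On the punctured plane \<open>ln |z|\<close> is not the real part of one holomorphic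
  function, so \<open>ln (x\<^sup>2 + y\<^sup>2) / 2\<close> is differentiated directly; the result
  \<open>x / (x\<^sup>2 + y\<^sup>2)\<close> is \<open>Re (1 / z)\<close>.\<close>

lemma has_real_derivative_ln_cmod_horizontal:
  assumes "Complex x y \<noteq> 0"
  shows "((\<lambda>t. ln (cmod (Complex t y))) has_real_derivative Re (1 / Complex x y)) (at x)"
proof -
  have pos: "x\<^sup>2 + y\<^sup>2 > 0"
    using assms by (auto simp: complex_eq_iff sum_power2_gt_zero_iff)
  have "((\<lambda>t. ln (t\<^sup>2 + y\<^sup>2) / 2) has_real_derivative x / (x\<^sup>2 + y\<^sup>2)) (at x)"
    using pos by (auto intro!: derivative_eq_intros simp: divide_simps)
  thus ?thesis
    by (simp add: cmod_def ln_sqrt Re_divide)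
qed

lemma has_real_derivative_ln_cmod_vertical:
  assumes "Complex x y \<noteq> 0"
  shows "((\<lambda>t. ln (cmod (Complex x t))) has_real_derivative - Im (1 / Complex x y)) (at y)"
proof -
  have pos: "x\<^sup>2 + y\<^sup>2 > 0"
    using assms by (auto simp: complex_eq_iff sum_power2_gt_zero_iff)
  have "((\<lambda>t. ln (x\<^sup>2 + t\<^sup>2) / 2) has_real_derivative y / (x\<^sup>2 + y\<^sup>2)) (at y)"
    using pos by (auto intro!: derivative_eq_intros simp: divide_simps)
  thus ?thesis
    by (simp add: cmod_def ln_sqrt Im_divide)
qed

lemma logarithmoid_eq: "logarithmoid = graph_over (- {0}) (\<lambda>x y. ln (cmod (Complex x y)))"
  by (simp add: logarithmoid_def cmod_def)

text \<open>Since \<open>|1 - z / c| = |z - c| / |c|\<close>, the height over \<open>z\<close> is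
  that of the logarithmoid over \<open>(z - c) / |c|\<close>. The argument of \<open>c\<close> would
  only add a rotation, under which the logarithmoid is invariant, so a real dilation factor
  suffices.\<close>

lemma graph_dilated_logarithmoid:
  assumes "c \<noteq> 0"
  shows "graph_over (- {c}) (\<lambda>x y. ln (cmod (1 - Complex x y / c))) =
           dilate_translate (cmod c) c ` logarithmoid" (is "?L = ?R")
proof (intro equalityI subsetI)
  have r: "cmod c > 0"
    using assms by simp
  have height: "cmod (1 - z / c) = cmod (z - c) / cmod c" for z
    using assms by (simp add: diff_divide_eq_iff norm_divide norm_minus_commute)
  fix q
  {
    assume "q \<in> ?L"
    then obtain x y where q: "q = (x, y, ln (cmod (1 - Complex x y / c)))" and ne: "Complex x y \<noteq> c"
      by (auto simp: graph_over_def)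
    \<comment> \<open>The point of the top view that the dilation and translation carry to
      \<open>Complex x y\<close>.\<close>
    define u where "u = (Complex x y - c) / of_real (cmod c)"
    have "u \<noteq> 0"
      using ne assms by (simp add: u_def)
    hence "(Re u, Im u, ln (cmod u)) \<in> logarithmoid"
      by (auto simp: logarithmoid_eq graph_over_def)
    moreover have "q = dilate_translate (cmod c) c (Re u, Im u, ln (cmod u))"
      using r by (simp add: q dilate_translate_def u_def height norm_divide)
    ultimately show "q \<in> ?R"
      by blast
  next
    assume "q \<in> ?R"
    then obtain x y where q: "q = dilate_translate (cmod c) c (x, y, ln (cmod (Complex x y)))"
      and ne: "Complex x y \<noteq> 0"
      by (auto simp: logarithmoid_eq graph_over_def)
    define u where "u = of_real (cmod c) * Complex x y + c"
    have "u \<noteq> c"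
      using ne assms by (simp add: u_def)
    moreover have "cmod (1 - u / c) = cmod (Complex x y)"
      unfolding height using r by (simp add: u_def norm_mult)
    hence "q = (Re u, Im u, ln (cmod (1 - u / c)))"
      by (simp add: q dilate_translate_def u_def)
    ultimately show "q \<in> ?L"
      by (auto simp: graph_over_def intro!: exI[of _ "Re u"] exI[of _ "Im u"])
  }
qed

lemma graphical_isotropic_minimal_surface_logarithmoid:
  "graphical_isotropic_minimal_surface logarithmoid"
  unfolding logarithmoid_eq
  by (rule graphical_isotropic_minimal_surface_gradient[where G = "\<lambda>z. 1 / z"])
     (auto intro!: holomorphic_intros has_real_derivative_ln_cmod_horizontal
        has_real_derivative_ln_cmod_vertical)

text \<open>The height is a translate of \<open>ln |z|\<close> minus the constant
  \<open>ln |c|\<close>, so \<open>1 / (z - c)\<close> encodes its gradient.\<close>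

lemma graphical_isotropic_minimal_surface_dilated_logarithmoid:
  assumes "c \<noteq> 0"
  shows "graphical_isotropic_minimal_surface (dilate_translate (cmod c) c ` logarithmoid)"
proof -
  have minus: "Complex x y - c = Complex (x - Re c) (y - Im c)" for x y
    by (simp add: complex_eq_iff)
  have shift: "ln (cmod (1 - Complex x y / c)) =
                 ln (cmod (Complex (x - Re c) (y - Im c))) - ln (cmod c)"
    if "Complex x y \<noteq> c" for x y
  proof -
    have "cmod (1 - Complex x y / c) = cmod (Complex x y - c) / cmod c"
      using assms by (simp add: diff_divide_eq_iff norm_divide norm_minus_commute)
    moreover have "Complex x y - c \<noteq> 0"
      using that by simp
    ultimately show ?thesis
      using assms by (simp add: ln_div minus)
  qed
  have eq: "graph_over (- {c}) (\<lambda>x y. ln (cmod (1 - Complex x y / c))) =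
        graph_over (- {c}) (\<lambda>x y. ln (cmod (Complex (x - Re c) (y - Im c))) - ln (cmod c))"
    unfolding graph_over_def using shift by auto
  have "graphical_isotropic_minimal_surface
          (graph_over (- {c}) (\<lambda>x y. ln (cmod (Complex (x - Re c) (y - Im c))) - ln (cmod c)))"
  proof (rule graphical_isotropic_minimal_surface_gradient[where G = "\<lambda>z. 1 / (z - c)"])
    fix x y assume "Complex x y \<in> - {c}"
    hence ne: "Complex (x - Re c) (y - Im c) \<noteq> 0"
      by (auto simp: complex_eq_iff)
    from DERIV_shift[THEN iffD1, of "\<lambda>t. ln (cmod (Complex t (y - Im c)))" _ x "- Re c"]
      has_real_derivative_ln_cmod_horizontal[OF ne]
    have "((\<lambda>t. ln (cmod (Complex (t - Re c) (y - Im c)))) has_real_derivative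
             Re (1 / (Complex x y - c))) (at x)"
      by (simp add: minus)
    from DERIV_diff[OF this DERIV_const[of "ln (cmod c)"]]
    show "((\<lambda>t. ln (cmod (Complex (t - Re c) (y - Im c))) - ln (cmod c)) has_real_derivative
             Re (1 / (Complex x y - c))) (at x)"
      by simp
    from DERIV_shift[THEN iffD1, of "\<lambda>t. ln (cmod (Complex (x - Re c) t))" _ y "- Im c"]
      has_real_derivative_ln_cmod_vertical[OF ne]
    have "((\<lambda>t. ln (cmod (Complex (x - Re c) (t - Im c)))) has_real_derivative
             - Im (1 / (Complex x y - c))) (at y)"
      by (simp add: minus)
    from DERIV_diff[OF this DERIV_const[of "ln (cmod c)"]]
    show "((\<lambda>t. ln (cmod (Complex (x - Re c) (t - Im c))) - ln (cmod c)) has_real_derivative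
             - Im (1 / (Complex x y - c))) (at y)"
      by simp
  qed (auto intro!: holomorphic_intros)
  thus ?thesis
    using eq graph_dilated_logarithmoid[OF assms] by simp
qed

section \<open>Primary factors and their exponents\<close>

text \<open>Each component of a product involves both components of its factors, so the two claims
  go through one simultaneous induction.\<close>

lemma real_polynomial_function_Re_Im_power:
  "real_polynomial_function (\<lambda>z. Re ((z / c) ^ n))"
  "real_polynomial_function (\<lambda>z. Im ((z / c) ^ n))"
proof (induction n)
  case (Suc n)
  have lin: "bounded_linear (\<lambda>z. Re (z / c))" "bounded_linear (\<lambda>z. Im (z / c))"
    using bounded_linear_compose[OF bounded_linear_Re bounded_linear_divide[of c]]
      bounded_linear_compose[OF bounded_linear_Im bounded_linear_divide[of c]]
    by (simp_all add: o_def)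
  {
    case 1
    show ?case
      unfolding power_Suc times_complex.sel
      by (intro real_polynomial_function_diff real_polynomial_function.intros(4,1) lin Suc.IH)
  next
    case 2
    show ?case
      unfolding power_Suc times_complex.sel
      by (intro real_polynomial_function.intros(3,4,1) lin Suc.IH)
  }
qed auto

lemma real_polynomial_function_Re_weierstrass_poly:
  "real_polynomial_function (\<lambda>z. Re (weierstrass_poly n (z / c)))"
  unfolding weierstrass_poly_def Re_sum Re_divide_of_nat
  by (intro real_polynomial_function_sum real_polynomial_function_divide
      real_polynomial_function_Re_Im_power finite_atLeastAtMost)

lemma weierstrass_poly_Suc:
  "weierstrass_poly (Suc n) w = weierstrass_poly n w + w ^ Suc n / of_nat (Suc n)"
  by (simp add: weierstrass_poly_def)

lemma weierstrass_factor_eq: "weierstrass_factor n w = (1 - w) * exp (weierstrass_poly n w)"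
  by (simp add: weierstrass_factor_def weierstrass_poly_def)

lemma holomorphic_weierstrass_poly:
  "(\<lambda>z. weierstrass_poly n (z / c)) holomorphic_on A" if "c \<noteq> 0"
  unfolding weierstrass_poly_def using that by (intro holomorphic_intros) auto

text \<open>Both factors are nonzero and \<open>|exp u| = exp (Re u)\<close>, so the logarithm
  splits.\<close>

lemma ln_cmod_weierstrass_factor:
  assumes "w \<noteq> 1"
  shows "ln (cmod (weierstrass_factor n w)) = ln (cmod (1 - w)) + Re (weierstrass_poly n w)"
  using assms by (simp add: weierstrass_factor_eq norm_mult ln_mult)

text \<open>If \<open>Re F\<close> vanished throughout the open set, both of its coordinate
  derivatives would be zero; these are \<open>Re F'\<close> and \<open>- Im F'\<close>.\<close>

lemma exists_Re_nonzero:
  assumes D: "open D" "D \<noteq> {}" and F: "F holomorphic_on D"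
    and F': "\<And>z. z \<in> D \<Longrightarrow> deriv F z \<noteq> 0"
  shows "\<exists>z\<in>D. Re (F z) \<noteq> 0"
proof (rule ccontr)
  assume "\<not> (\<exists>z\<in>D. Re (F z) \<noteq> 0)"
  hence zero: "Re (F z) = 0" if "z \<in> D" for z
    using that by blast
  obtain x y where z: "Complex x y \<in> D"
    using D(2) by (metis complex.exhaust ex_in_conv)
  note dF = holomorphic_derivI[OF F D(1) z]
  have "((\<lambda>t. 0) has_real_derivative Re (deriv F (Complex x y))) (at x)"
    by (rule has_field_derivative_transform_within_open[OF
          has_real_derivative_horizontal(1)[OF dF] open_horizontal_slice[OF D(1)]])
       (use z zero in auto)
  moreover have "((\<lambda>t. 0) has_real_derivative - Im (deriv F (Complex x y))) (at y)"
    by (rule has_field_derivative_transform_within_open[OF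
          has_real_derivative_vertical(1)[OF dF] open_vertical_slice[OF D(1)]])
       (use z zero in auto)
  ultimately have "deriv F (Complex x y) = 0"
    using DERIV_unique[OF _ DERIV_const] by (force simp: complex_eq_iff)
  thus False
    using F'[OF z] by simp
qed

section \<open>Weierstrass representations: existence and change of degree\<close>

text \<open>The zeros are isolated and each is listed finitely often, so the moduli of the
  \<open>a n\<close> tend to infinity; degree \<open>n\<close> for the factor of \<open>a n\<close>
  then makes the canonical product converge.\<close>

lemma weierstrass_representation_exists:
  fixes a :: "nat \<Rightarrow> complex" and f :: "complex \<Rightarrow> complex"
  assumes a_nonzero: "\<And>n. n \<ge> 1 \<Longrightarrow> a n \<noteq> 0"
    and f_entire: "f holomorphic_on UNIV"
    and f_not_zero: "\<exists>z. f z \<noteq> 0"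
    and zeros: "\<And>w. w \<noteq> 0 \<Longrightarrow>
                  finite {n. n \<ge> 1 \<and> a n = w} \<and> zorder f w = int (card {n. n \<ge> 1 \<and> a n = w})"
    and order_0: "zorder f 0 = int k"
  shows "\<exists>g. weierstrass_representation f k a (\<lambda>n. n) g"
proof -
  \<comment> \<open>The locales for Weierstrass products index from 0, so \<open>b n\<close> stands
    for \<open>a (Suc n)\<close>.\<close>
  define b where "b = (\<lambda>n. a (Suc n))"
  have b_nonzero: "b n \<noteq> 0" for n
    using a_nonzero[of "Suc n"] by (simp add: b_def)
  have shift: "{n. n \<ge> 1 \<and> a n = w} = Suc ` (b -` {w})" for w
  proof (intro equalityI subsetI)
    fix n assume "n \<in> {n. n \<ge> 1 \<and> a n = w}"
    thus "n \<in> Suc ` (b -` {w})"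
      by (cases n) (auto simp: b_def)
  qed (auto simp: b_def)
  have fin: "finite (b -` {w})" and ord: "zorder f w = int (card (b -` {w}))" if "w \<noteq> 0" for w
    using zeros[OF that] unfolding shift by (simp_all add: finite_image_iff card_image)
  have f_ana: "f analytic_on {z}" for z
    using f_entire by (simp add: holomorphic_on_imp_analytic_at)
  \<comment> \<open>By the identity theorem the zeros of \<open>f\<close> are isolated; hence
    \<open>zorder\<close> is 0 exactly where \<open>f\<close> does not vanish.\<close>
  have f_ev: "eventually (\<lambda>w. f w \<noteq> 0) (at z)" for z
    using f_not_zero non_zero_neighbour_alt[OF f_entire open_UNIV connected_UNIV]
    by (auto elim!: eventually_mono)
  have f_freq: "frequently (\<lambda>w. f w \<noteq> 0) (at z)" for z
    using f_ev by (rule eventually_frequently[rotated]) auto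
  have f_zero_iff: "f z = 0 \<longleftrightarrow> zorder f z \<noteq> 0" for z
    using zorder_eq_0_iff[OF f_ana f_freq] by blast
  have f_b: "f (b n) = 0" for n
  proof -
    have "card (b -` {b n}) \<noteq> 0"
      using fin[OF b_nonzero[of n]] by (auto simp: card_eq_0_iff)
    thus ?thesis
      by (simp add: f_zero_iff ord[OF b_nonzero])
  qed
  \<comment> \<open>A disc contains finitely many zeros of \<open>f\<close>, and \<open>b\<close>
    takes each nonzero value finitely often, so only finitely many \<open>b n\<close> lie in the
    disc.\<close>
  have "filterlim b at_infinity at_top"
    unfolding filterlim_at_infinity_conv_norm_at_top filterlim_at_top
  proof
    fix C :: real
    have "finite {z \<in> cball 0 C. f z = 0}"
    proof (rule holomorphic_compact_finite_zeros[OF f_entire])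
      \<comment> \<open>A constant \<open>f\<close> would be identically 0, because
        \<open>b 0\<close> is a zero.\<close>
      show "\<not> f constant_on UNIV"
        using f_not_zero f_b[of 0] by (metis UNIV_I constant_on_def)
    qed (auto intro: connected_UNIV)
    hence "finite (\<Union>w\<in>{z \<in> cball 0 C. f z = 0} - {0}. b -` {w})"
      using fin by (intro finite_UN_I) auto
    moreover have "{n. \<not> C \<le> cmod (b n)} \<subseteq> (\<Union>w\<in>{z \<in> cball 0 C. f z = 0} - {0}. b -` {w})"
      using f_b b_nonzero by auto
    ultimately show "eventually (\<lambda>n. C \<le> cmod (b n)) sequentially"
      using finite_subset by (auto simp: eventually_cofinite simp flip: cofinite_eq_sequentially)
  qed
  then interpret B: weierstrass_product' b
  proof unfold_locales
    show "finite (b -` {z})" if "z \<in> range b" for z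
      using that b_nonzero by (intro fin) auto
  qed (rule b_nonzero)
  \<comment> \<open>The factor of \<open>b n\<close> has degree \<open>Suc n\<close> because it
    belongs to \<open>a (Suc n)\<close>. \<open>B\<close> gives summability with exponent
    \<open>Suc n\<close>; one further power is harmless since \<open>r / |b n|\<close> is eventually
    at most 1.\<close>
  interpret W: weierstrass_product b Suc
  proof
    show "summable (\<lambda>n. (r / cmod (b n)) ^ Suc (Suc n))" if "r > 0" for r
    proof (rule summable_comparison_test_ev[OF _ B.summable_a_p[OF that]])
      have "eventually (\<lambda>n. cmod (b n) \<ge> r) sequentially"
        using B.filterlim_a by (simp add: filterlim_at_infinity_conv_norm_at_top filterlim_at_top)
      thus "eventually (\<lambda>n. norm ((r / cmod (b n)) ^ Suc (Suc n)) \<le> (r / cmod (b n)) ^ Suc n)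
              sequentially"
      proof eventually_elim
        case (elim n)
        hence "r / cmod (b n) \<le> 1"
          using b_nonzero[of n] by (simp add: divide_le_eq)
        hence "(r / cmod (b n)) ^ Suc (Suc n) \<le> (r / cmod (b n)) ^ Suc n"
          using that by (intro power_decreasing) auto
        thus ?case
          using that by simp
      qed
    qed
  qed (rule b_nonzero B.filterlim_a)+
  define P where "P = W.f"
  define F where "F = (\<lambda>z. z ^ k * P z)"
  have P_ana: "P analytic_on {z}" for z
    unfolding P_def by (rule W.analytic)
  have P_ev: "eventually (\<lambda>w. P w \<noteq> 0) (at z)" for z
    using W.not_islimpt_range_a[of z] by (auto simp: islimpt_iff_eventually W.zero P_def)
  have ev: "eventually (\<lambda>w. w ^ k * P w \<noteq> 0) (at z)" for z
    using P_ev[of z] eventually_neq_at_within[of 0 z UNIV] by eventually_elim auto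
  have ord_pow: "zorder (\<lambda>w. w ^ k) z = (if z = 0 then int k else 0)" for z :: complex
  proof (cases "z = 0")
    case True
    show ?thesis
      unfolding True by (rule zorder_eqI[where g = "\<lambda>_. 1" and S = UNIV]) auto
  next
    case False
    thus ?thesis
      by (simp, intro zorder_eq_0I analytic_intros) auto
  qed
  \<comment> \<open>Orders add under multiplication. Away from 0 the canonical product contributes
    the multiplicity; at 0 it contributes nothing, as no \<open>b n\<close> is 0, and the power
    contributes \<open>k\<close>.\<close>
  have ord_F: "zorder F z = zorder f z" for z
  proof -
    have "zorder F z = zorder (\<lambda>w. w ^ k) z + zorder P z"
      unfolding F_def by (intro zorder_times_analytic ev P_ana analytic_intros)
    moreover have "zorder P z = int (card (b -` {z}))"
      unfolding P_def by (rule W.zorder)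
    moreover have "b -` {0} = {}"
      using b_nonzero by auto
    ultimately show ?thesis
      by (simp add: ord_pow ord order_0)
  qed
  have F_holo: "F holomorphic_on UNIV"
    unfolding F_def P_def by (intro holomorphic_intros W.holomorphic)
  have F_zero_iff: "F z = 0 \<longleftrightarrow> f z = 0" for z
  proof -
    have "F analytic_on {z}"
      unfolding F_def by (intro analytic_intros P_ana)
    moreover have "frequently (\<lambda>w. F w \<noteq> 0) (at z)"
      unfolding F_def using ev by (rule eventually_frequently[rotated]) auto
    ultimately show ?thesis
      using zorder_eq_0_iff[of F z] by (simp add: f_zero_iff ord_F)
  qed
  \<comment> \<open>Equal orders everywhere make the quotient a zero-free entire function, which has
    a holomorphic logarithm on the simply connected plane.\<close>
  obtain q where q: "q holomorphic_on UNIV" "\<And>z. q z \<noteq> 0" "\<And>z. f z = q z * F z"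
    using holomorphic_zorder_factorization[OF f_entire open_UNIV connected_UNIV F_holo]
      F_zero_iff ord_F by (metis UNIV_I)
  obtain g where g: "g holomorphic_on UNIV" "\<And>z. q z = exp (g z)"
    using q(1,2) simply_connected_eq_holomorphic_log[OF open_UNIV]
      convex_imp_simply_connected[OF convex_UNIV] by (metis UNIV_I)
  have "convergent_prod (\<lambda>n. weierstrass_factor (Suc n) (z / a (Suc n)))" for z
    using W.convergent[of z] by (simp add: b_def)
  moreover have "f z = z ^ k * exp (g z) * (\<Prod>n. weierstrass_factor (Suc n) (z / a (Suc n)))" for z
    by (simp add: q(3) g(2) F_def P_def W.f_def) (simp add: b_def)
  ultimately show ?thesis
    unfolding weierstrass_representation_def using g(1) by blast
qed

text \<open>Raising the degree of one primary factor by one multiplies that factor by the exponential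
  of a monomial, which the entire function \<open>g\<close> can absorb.\<close>

lemma weierstrass_representation_raise_degree:
  assumes rep: "weierstrass_representation f k a p g" and "a 1 \<noteq> 0"
  shows "weierstrass_representation f k a (p(1 := Suc (p 1)))
           (\<lambda>z. g z - (z / a 1) ^ Suc (p 1) / of_nat (Suc (p 1)))"
  unfolding weierstrass_representation_def
proof (intro conjI allI)
  have g: "g holomorphic_on UNIV"
    using rep by (simp add: weierstrass_representation_def)
  show "(\<lambda>z. g z - (z / a 1) ^ Suc (p 1) / of_nat (Suc (p 1))) holomorphic_on UNIV"
    using assms(2) by (intro holomorphic_intros g) (auto simp del: of_nat_Suc)
  fix z
  define E where "E = (\<lambda>n. weierstrass_factor (p (Suc n)) (z / a (Suc n)))"
  define E' where "E' = (\<lambda>n. weierstrass_factor ((p(1 := Suc (p 1))) (Suc n)) (z / a (Suc n)))"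
  define c where "c = (z / a 1) ^ Suc (p 1) / of_nat (Suc (p 1))"
  have E: "convergent_prod E" "f z = z ^ k * exp (g z) * prodinf E"
    using rep by (auto simp: weierstrass_representation_def E_def)
  \<comment> \<open>Index 0 carries the factor of \<open>a 1\<close>, so the two products differ by
    the single factor \<open>exp c\<close>.\<close>
  have E'_eq: "E' n = E n * (if n = 0 then exp c else 1)" for n
    by (simp add: E_def E'_def c_def weierstrass_factor_eq weierstrass_poly_Suc exp_add
        del: of_nat_Suc power_Suc)
  have "E' has_prod (prodinf E * exp c)"
    unfolding E'_eq[abs_def]
    by (intro has_prod_mult convergent_prod_has_prod E(1) has_prod_single[of 0 "\<lambda>_. exp c"])
  hence E': "convergent_prod E'" "prodinf E' = prodinf E * exp c"
    by (auto simp: has_prod_iff)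
  show "convergent_prod (\<lambda>n. weierstrass_factor ((p(1 := Suc (p 1))) (Suc n)) (z / a (Suc n)))"
    using E'(1) by (simp add: E'_def)
  have "f z = z ^ k * exp (g z - c) * prodinf E'"
    by (simp add: E(2) E'(2) exp_diff)
  thus "f z = z ^ k * exp (g z - (z / a 1) ^ Suc (p 1) / of_nat (Suc (p 1))) *
              (\<Prod>n. weierstrass_factor ((p(1 := Suc (p 1))) (Suc n)) (z / a (Suc n)))"
    by (simp only: c_def E'_def)
qed

section \<open>From a representation to the height formula and its components\<close>

text \<open>Logarithms of partial products yield convergence of the combined series of
  \<open>A (Suc n) + B (Suc n)\<close>; the claims about the separate series then follow by
  linearity.\<close>

lemma height_formula_of_representation:
  assumes rep: "weierstrass_representation f k a p g"
    and a: "\<And>n. n \<ge> 1 \<Longrightarrow> a n \<noteq> 0"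
    and D: "0 \<notin> D" "\<And>n. n \<ge> 1 \<Longrightarrow> a n \<notin> D"
    and L: "\<And>z. z \<in> D \<Longrightarrow> exp (L z) = f z"
    and h: "\<And>x y. Complex x y \<in> D \<Longrightarrow> h x y = Re (L (Complex x y))"
  shows "height_formula D h k a p g"
  unfolding height_formula_def Let_def
proof (intro allI impI)
  fix x y assume xy: "Complex x y \<in> D"
  define z where "z = Complex x y"
  define A where "A = (\<lambda>n. ln (cmod (1 - z / a n)))"
  define B where "B = (\<lambda>n. Re (weierstrass_poly (p n) (z / a n)))"
  define E where "E = (\<lambda>n. weierstrass_factor (p (Suc n)) (z / a (Suc n)))"
  define s where "s = real k * ln (cmod z) + Re (g z)"
  have "z \<in> D"
    using xy by (simp add: z_def)
  have "z \<noteq> 0"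
    using \<open>z \<in> D\<close> D(1) by blast
  \<comment> \<open>As \<open>D\<close> avoids the zeros, no factor \<open>1 - z / a n\<close>
    vanishes, so \<open>ln\<close> splits over the finite products.\<close>
  have ne: "z / a (Suc n) \<noteq> 1" for n
    using \<open>z \<in> D\<close> D(2)[of "Suc n"] a[of "Suc n"] by auto
  have E: "convergent_prod E" and fz: "f z = z ^ k * exp (g z) * prodinf E"
    using rep by (auto simp: weierstrass_representation_def E_def)
  \<comment> \<open>An exponential is nonzero, hence so is the infinite product, and
    \<open>ln\<close> is continuous at the limit of the moduli.\<close>
  have "f z \<noteq> 0"
    using L[OF \<open>z \<in> D\<close>] by (metis exp_not_eq_zero)
  hence "prodinf E \<noteq> 0"
    using fz by auto
  \<comment> \<open>Since \<open>|exp (L z)| = exp (Re (L z))\<close>, the choice of branch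
    \<open>L\<close> does not affect the height.\<close>
  have "h x y = ln (cmod (f z))"
    using h[OF xy] by (simp add: z_def xy flip: L)
  hence hxy: "h x y = s + ln (cmod (prodinf E))"
    using \<open>z \<noteq> 0\<close> \<open>prodinf E \<noteq> 0\<close>
    by (simp add: fz s_def norm_mult norm_power ln_mult ln_realpow)
  have "(\<lambda>N. \<Prod>n<N. E n) \<longlonglongrightarrow> prodinf E"
    using convergent_prod_LIMSEQ[OF E] by (subst (asm) LIMSEQ_lessThan_iff_atMost[symmetric])
  hence "(\<lambda>N. ln (cmod (\<Prod>n<N. E n))) \<longlonglongrightarrow> ln (cmod (prodinf E))"
    using \<open>prodinf E \<noteq> 0\<close> by (intro tendsto_ln tendsto_norm) auto
  moreover have "ln (cmod (\<Prod>n<N. E n)) = (\<Sum>n<N. A (Suc n) + B (Suc n))" for N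
  proof -
    have "ln (cmod (\<Prod>n<N. E n)) = (\<Sum>n<N. ln (cmod (E n)))"
      unfolding prod_norm[symmetric] using ne by (intro ln_prod) (auto simp: E_def)
    also have "\<dots> = (\<Sum>n<N. A (Suc n) + B (Suc n))"
      using ne by (simp add: E_def A_def B_def ln_cmod_weierstrass_factor)
    finally show ?thesis .
  qed
  ultimately have AB: "(\<lambda>n. A (Suc n) + B (Suc n)) sums ln (cmod (prodinf E))"
    by (simp add: sums_def)
  have shift: "(\<Sum>n<N. t (Suc n)) = (\<Sum>n=1..N. t n)" for t :: "nat \<Rightarrow> real" and N
    by (rule sum.reindex_bij_witness[of _ "\<lambda>n. n - 1" Suc]) auto
  have "(\<lambda>N. s + (\<Sum>n<N. A (Suc n) + B (Suc n))) \<longlonglongrightarrow> h x y"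
    unfolding hxy by (intro tendsto_intros AB[unfolded sums_def])
  hence lim: "(\<lambda>N. s + (\<Sum>n=1..N. A n) + (\<Sum>n=1..N. B n)) \<longlonglongrightarrow> h x y"
    by (simp add: sum.distrib shift add.assoc)
  \<comment> \<open>Each series is the difference of the convergent combined series and the other
    one.\<close>
  have summ: "summable (\<lambda>n. A (Suc n)) \<longleftrightarrow> summable (\<lambda>n. B (Suc n))"
  proof
    assume "summable (\<lambda>n. A (Suc n))"
    from summable_diff[OF sums_summable[OF AB] this]
    show "summable (\<lambda>n. B (Suc n))"
      by simp
  next
    assume "summable (\<lambda>n. B (Suc n))"
    from summable_diff[OF sums_summable[OF AB] this]
    show "summable (\<lambda>n. A (Suc n))"
      by simp
  qed
  have "h x y = s + (\<Sum>n. A (Suc n)) + (\<Sum>n. B (Suc n))" if "summable (\<lambda>n. A (Suc n))"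
    using suminf_add[OF that that[unfolded summ]] AB by (simp add: hxy sums_iff)
  with lim summ show
    "(\<lambda>N. real k * ln (cmod (Complex x y)) + Re (g (Complex x y)) +
          (\<Sum>n=1..N. ln (cmod (1 - Complex x y / a n))) +
          (\<Sum>n=1..N. Re (weierstrass_poly (p n) (Complex x y / a n)))) \<longlonglongrightarrow> h x y \<and>
     (summable (\<lambda>n. ln (cmod (1 - Complex x y / a (Suc n)))) \<longleftrightarrow>
      summable (\<lambda>n. Re (weierstrass_poly (p (Suc n)) (Complex x y / a (Suc n))))) \<and>
     (summable (\<lambda>n. ln (cmod (1 - Complex x y / a (Suc n)))) \<longrightarrow>
      h x y = real k * ln (cmod (Complex x y)) + Re (g (Complex x y)) +
        (\<Sum>n. ln (cmod (1 - Complex x y / a (Suc n)))) +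
        (\<Sum>n. Re (weierstrass_poly (p (Suc n)) (Complex x y / a (Suc n)))))"
    unfolding s_def A_def B_def z_def by blast
qed

text \<open>Only the height formula involves \<open>D\<close> and \<open>h\<close>; the other
  conjuncts concern single components and follow from the results above, with \<open>a n\<close>
  nonzero and \<open>g\<close> entire.\<close>

lemma logarithmoid_decomposition_of_height_formula:
  assumes "height_formula D h k a p g" "g holomorphic_on UNIV" "\<And>n. n \<ge> 1 \<Longrightarrow> a n \<noteq> 0"
  shows "logarithmoid_decomposition D h k a p g"
proof -
  have "graphical_isotropic_minimal_surface
          (graph_over UNIV (\<lambda>x y. Re (weierstrass_poly (p n) (Complex x y / a n))))"
    if "n \<ge> 1" for n
    using graphical_isotropic_minimal_surface_Re[OF open_UNIV
        holomorphic_weierstrass_poly[OF assms(3)[OF that]]] .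
  with assms show ?thesis
    by (simp add: logarithmoid_decomposition_def graph_dilated_logarithmoid
        graphical_isotropic_minimal_surface_logarithmoid
        graphical_isotropic_minimal_surface_dilated_logarithmoid
        graphical_isotropic_minimal_surface_Re
        real_polynomial_function_Re_weierstrass_poly flip: logarithmoid_eq)
qed

section \<open>Decomposition of the surface and its non-uniqueness\<close>

theorem theorem3p1:
  fixes a :: "nat \<Rightarrow> complex" and f L :: "complex \<Rightarrow> complex" and k :: nat
    and D :: "complex set" and h :: "real \<Rightarrow> real \<Rightarrow> real" and X :: "(real \<times> real \<times> real) set"
  assumes a_nonzero: "\<And>n. n \<ge> 1 \<Longrightarrow> a n \<noteq> 0"
    and f_entire: "f holomorphic_on UNIV"
    and f_not_zero: "\<exists>z. f z \<noteq> 0"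
    and zeros: "\<And>w. w \<noteq> 0 \<Longrightarrow>
                  finite {n. n \<ge> 1 \<and> a n = w} \<and> zorder f w = int (card {n. n \<ge> 1 \<and> a n = w})"
    and order_0: "zorder f 0 = int k"
    and D: "open D" "connected D" "simply_connected D" "D \<noteq> {}"
    and D_avoids: "0 \<notin> D" "\<And>n. n \<ge> 1 \<Longrightarrow> a n \<notin> D"
    and L: "\<And>z. z \<in> D \<Longrightarrow> exp (L z) = f z"
    and h: "\<And>x y. Complex x y \<in> D \<Longrightarrow> h x y = Re (L (Complex x y))"
    and X: "X = graph_over D h" "graphical_isotropic_minimal_surface X"
  shows "(\<exists>g. weierstrass_representation f k a (\<lambda>n. n) g) \<and>
         (\<forall>p g. weierstrass_representation f k a p g \<longrightarrow>
            logarithmoid_decomposition D h k a p g \<and>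
            (\<exists>p' g'. weierstrass_representation f k a p' g' \<and>
                     logarithmoid_decomposition D h k a p' g' \<and>
                     (\<exists>z\<in>D. Re (g' z) \<noteq> Re (g z)) \<and>
                     (\<exists>n\<ge>1. \<exists>z\<in>D. Re (weierstrass_poly (p' n) (z / a n)) \<noteq>
                                   Re (weierstrass_poly (p n) (z / a n)))))"
proof (intro conjI allI impI)
  show "\<exists>g. weierstrass_representation f k a (\<lambda>n. n) g"
    by (rule weierstrass_representation_exists[OF a_nonzero f_entire f_not_zero zeros order_0])
next
  \<comment> \<open>Stated for every representation, since it is applied both to the given one and
    to the modified one.\<close>
  have dec: "logarithmoid_decomposition D h k a p g" if "weierstrass_representation f k a p g"
    for p g
  proof (rule logarithmoid_decomposition_of_height_formula)
    show "height_formula D h k a p g"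
      by (rule height_formula_of_representation[OF that a_nonzero D_avoids L h])
    show "g holomorphic_on UNIV"
      using that by (simp add: weierstrass_representation_def)
  qed (rule a_nonzero)
  fix p g assume rep: "weierstrass_representation f k a p g"
  show "logarithmoid_decomposition D h k a p g"
    by (rule dec[OF rep])
  \<comment> \<open>\<open>M\<close> is the monomial that the exponent of the factor of
    \<open>a 1\<close> gains, and that \<open>g\<close> loses, when the degree rises from
    \<open>p 1\<close> to \<open>m\<close>.\<close>
  define m where "m = Suc (p 1)"
  define M where "M = (\<lambda>z. (z / a 1) ^ m / of_nat m)"
  have "a 1 \<noteq> 0" "m > 0"
    by (simp_all add: a_nonzero m_def)
  have dM: "(M has_field_derivative (z / a 1) ^ (m - 1) / a 1) (at z)" for z
    unfolding M_def using \<open>a 1 \<noteq> 0\<close> \<open>m > 0\<close>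
    by (auto intro!: derivative_eq_intros)
  \<comment> \<open>The derivative of \<open>M\<close> can vanish only at 0, which lies outside
    \<open>D\<close>. The point obtained witnesses both the change of \<open>g\<close> and the
    change of the polynomial.\<close>
  have "\<exists>z\<in>D. Re (M z) \<noteq> 0"
  proof (rule exists_Re_nonzero[OF D(1,4)])
    show "M holomorphic_on D"
      using dM by (meson holomorphic_onI field_differentiable_at_within field_differentiable_def)
    show "deriv M z \<noteq> 0" if "z \<in> D" for z
      using that D_avoids(1) \<open>a 1 \<noteq> 0\<close> by (auto simp: DERIV_imp_deriv[OF dM])
  qed
  then obtain z where z: "z \<in> D" "Re (M z) \<noteq> 0"
    by blast
  have rep': "weierstrass_representation f k a (p(1 := m)) (\<lambda>z. g z - M z)"
    unfolding m_def M_def using rep \<open>a 1 \<noteq> 0\<close> by (rule weierstrass_representation_raise_degree)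
  have "weierstrass_poly m (z / a 1) = weierstrass_poly (p 1) (z / a 1) + M z"
    by (simp only: M_def m_def weierstrass_poly_Suc)
  hence "Re (weierstrass_poly ((p(1 := m)) 1) (z / a 1)) \<noteq> Re (weierstrass_poly (p 1) (z / a 1))"
    using z(2) by simp
  moreover have "Re (g z - M z) \<noteq> Re (g z)"
    using z(2) by simp
  ultimately show "\<exists>p' g'. weierstrass_representation f k a p' g' \<and>
                 logarithmoid_decomposition D h k a p' g' \<and>
                 (\<exists>z\<in>D. Re (g' z) \<noteq> Re (g z)) \<and>
                 (\<exists>n\<ge>1. \<exists>z\<in>D. Re (weierstrass_poly (p' n) (z / a n)) \<noteq>
                               Re (weierstrass_poly (p n) (z / a n)))"
    using rep' dec[OF rep'] z(1) by blast
qed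

end
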